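(* For any integer $\alpha\geq 2$, the graph $G(\alpha,\alpha-1,1)$ has a Hamilton cycle.
   Context: For an integer partition $\mathbf{a}=(a_1,\ldots,a_k)$ ($a_1\geq\cdots\geq a_k\geq 1$, $n=a_1+\cdots+a_k$), $G(\mathbf{a})$ is the graph whose vertices are all strings of length $n$ over $\{1,\ldots,k\}$ containing exactly $a_i$ occurrences of symbol $i$, two strings being adjacent if one arises from the other by swapping the first entry with an entry at some position $2,\ldots,n$ distinct from the first entry. *)

theory Defs
  imports "Graph_Theory.Graph_Theory"
begin

(* Symbol i occurs "a ! (i - 1)" times because the symbols are numbered from 1. *)
definition multiset_strings :: "nat list \<Rightarrow> nat list set" where
  "multiset_strings a =
     {x. length x = sum_list a \<and> set x \<subseteq> {1..length a} \<and>
         (\<forall>i\<in>{1..length a}. count_list x i = a ! (i - 1))}"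

(* List positions are numbered from 0: the first entry is "x ! 0", and the positions 2, ..., n
   are the indices j with 1 <= j < n.
   An undirected simple graph is a pair_graph, i.e. a symmetric loop-free digraph on a finite
   vertex set whose arcs are pairs of vertices; the last lemma of this theory shows that the
   graph below is one. *)
definition star_transposition_graph :: "nat list \<Rightarrow> nat list pair_pre_digraph" where
  "star_transposition_graph a =
     \<lparr> pverts = multiset_strings a,
       parcs = {(x, y). x \<in> multiset_strings a \<and> y \<in> multiset_strings a \<and>
                  (\<exists>j. 1 \<le> j \<and> j < length x \<and> x ! j \<noteq> x ! 0 \<and>
                       y = x[0 := x ! j, j := x ! 0])} \<rparr>"

(* The library's cycle visits no vertex twice, but in a symmetric digraph it admits the closed
   walk u, v, u; the bound on the length excludes it. The tails of the arcs of a cycle are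
   exactly the vertices on it. *)
definition hamilton_cycle :: "('a, 'b) pre_digraph \<Rightarrow> 'b list \<Rightarrow> bool" where
  "hamilton_cycle G p \<longleftrightarrow> pre_digraph.cycle G p \<and> 3 \<le> length p \<and> tail G ` set p = verts G"

lemma finite_multiset_strings: "finite (multiset_strings a)"
proof -
  have "multiset_strings a \<subseteq> {x. set x \<subseteq> {1..length a} \<and> length x = sum_list a}"
    by (auto simp: multiset_strings_def)
  then show ?thesis
    using finite_lists_length_eq[of "{1..length a}"] finite_subset by blast
qed

lemma star_transposition_sym:
  assumes "(x, y) \<in> parcs (star_transposition_graph a)"
  shows "(y, x) \<in> parcs (star_transposition_graph a)"
proof -
  obtain j where j: "1 \<le> j" "j < length x" "x ! j \<noteq> x ! 0" "y = x[0 := x ! j, j := x ! 0]"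
    using assms by (auto simp: star_transposition_graph_def)
  have ne: "x \<noteq> []" using j(2) by auto
  have y: "y ! j = x ! 0" "y ! 0 = x ! j" "length y = length x"
    using j ne by (auto simp: nth_list_update)
  have "x = y[0 := y ! j, j := y ! 0]"
    by (rule nth_equalityI) (use j(2,4) ne in \<open>auto simp: y nth_list_update\<close>)
  moreover have "y ! j \<noteq> y ! 0" "j < length y"
    using j(2,3) y by simp_all
  ultimately show ?thesis
    using assms j(1) by (auto simp: star_transposition_graph_def)
qed

lemma pair_graph_star_transposition_graph: "pair_graph (star_transposition_graph a)"
proof
  show "finite (pverts (star_transposition_graph a))"
    by (simp add: star_transposition_graph_def finite_multiset_strings)
  have "parcs (star_transposition_graph a) \<subseteq> multiset_strings a \<times> multiset_strings a"
    by (auto simp: star_transposition_graph_def)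
  then show "finite (parcs (star_transposition_graph a))"
    using finite_multiset_strings finite_subset by blast
  show "symmetric (with_proj (star_transposition_graph a))"
    using star_transposition_sym by (auto simp: symmetric_def arcs_ends_def arc_to_ends_def sym_def)
  show "fst e \<noteq> snd e" if e: "e \<in> parcs (star_transposition_graph a)" for e
  proof -
    obtain j where j: "1 \<le> j" "j < length (fst e)" "fst e ! j \<noteq> fst e ! 0"
      "snd e = (fst e)[0 := fst e ! j, j := fst e ! 0]"
      using e by (cases e) (auto simp: star_transposition_graph_def)
    then have "snd e ! j = fst e ! 0" by (simp add: nth_list_update)
    with j(3) show ?thesis by metis
  qed
qed (auto simp: star_transposition_graph_def)

end

theory Submission
  imports Defs
begin

text \<open>Put \<open>\<alpha> = n + 1\<close>. The letters 1 are exactly half of all letters, so a Hamilton cycle alternates between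
  strings that start with 1 and strings that do not. After the leading 1, a string of the first kind
  is a rotation of a unique word \<open>D r\<close> with \<open>D\<close> a Dyck word (1 is the up step, 2 and 3 are down steps)
  and \<open>r \<noteq> 1\<close>. Such a word is an ordered tree with \<open>n\<close> edges whose vertices are the letters other
  than 1; one vertex is marked by 3. Swapping the leading 1 with the partner of the first step of \<open>D\<close>,
  and then back with that first step, moves the root to its first child and rotates the word by one.
  These double steps form a 2-factor whose cycles correspond to plane trees with a marked vertex.

  Pulling a leaf, \<open>1 1 2 u 2 v\<close> to \<open>1 2 1 u 2 v\<close>, gives a 6-cycle that meets the 2-factor in three
  edges and merges the two cycles. Because only trees at rotation offset 0 are used, all
  these modifications have disjoint supports, and they can be applied greedily. With the mark as the
  root, pulling leaves towards the root turns every tree into a star, so everything gets merged.\<close>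

subsection \<open>Dyck words and rotations of ordered trees\<close>

definition height :: "nat list \<Rightarrow> int" where
  "height xs = (\<Sum>c\<leftarrow>xs. if c = 1 then 1 else -1)"

lemma height_simps [simp]:
  "height [] = 0"
  "height (c # xs) = (if c = 1 then 1 else -1) + height xs"
  "height (xs @ ys) = height xs + height ys"
  by (simp_all add: height_def)

text \<open>The rule is the first-return decomposition. A down step may be any letter other than 1,
  so a Dyck word carries labels on its down steps.\<close>

inductive dyck :: "nat list \<Rightarrow> bool" where
  Nil [simp, intro]: "dyck []"
| Cons: "dyck u \<Longrightarrow> a \<noteq> 1 \<Longrightarrow> dyck v \<Longrightarrow> dyck (1 # u @ a # v)"

lemma dyck_append: "dyck u \<Longrightarrow> dyck v \<Longrightarrow> dyck (u @ v)"
proof (induction rule: dyck.induct)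
  case (Cons u a w)
  then show ?case using dyck.Cons[of u a "w @ v"] by simp
qed simp

lemma dyck_height: "dyck x \<Longrightarrow> height x = 0"
  by (induction rule: dyck.induct) auto

lemma dyck_prefix_nonneg:
  assumes "dyck x" "x = p @ q"
  shows "0 \<le> height p"
  using assms
proof (induction arbitrary: p q rule: dyck.induct)
  case (Cons u a v)
  show ?case
  proof (cases p)
    case (Cons c p')
    then have p: "p = 1 # p'" and eq: "u @ a # v = p' @ q"
      using Cons.prems by auto
    consider us where "u = p' @ us" | us where "p' = u @ a # us" "v = us @ q"
      using eq by (fastforce simp: append_eq_append_conv2 Cons_eq_append_conv)
    then show ?thesis
    proof cases
      case 1
      then show ?thesis using Cons.IH(1) p by fastforce
    next
      case 2
      then show ?thesis using Cons.IH(2) p dyck_height[OF Cons.hyps(1)] by fastforce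
    qed
  qed simp
qed simp

lemma dyck_iff:
  "dyck x \<longleftrightarrow> height x = 0 \<and> (\<forall>p q. x = p @ q \<longrightarrow> 0 \<le> height p)"
proof
  show "height x = 0 \<and> (\<forall>p q. x = p @ q \<longrightarrow> 0 \<le> height p)" if "dyck x"
    using that dyck_height dyck_prefix_nonneg by blast
next
  assume "height x = 0 \<and> (\<forall>p q. x = p @ q \<longrightarrow> 0 \<le> height p)"
  then show "dyck x"
  proof (induction x rule: length_induct)
    case (1 x)
    then have h0: "height x = 0" and pre: "\<And>p q. x = p @ q \<Longrightarrow> 0 \<le> height p"
      by auto
    show ?case
    proof (cases x)
      case (Cons c y)
      have c: "c = 1" using pre[of "[c]" y] Cons by (auto split: if_splits)
      \<comment> \<open>The shortest prefix of \<open>y\<close> with negative height ends with the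
        partner of the leading 1.\<close>
      define k where "k = (LEAST k. height (take k y) < 0)"
      have ex: "height (take (length y) y) < 0" using h0 Cons c by simp
      then have k: "height (take k y) < 0" unfolding k_def by (rule LeastI)
      have below: "0 \<le> height (take j y)" if "j < k" for j
        using not_less_Least[of j "\<lambda>k. height (take k y) < 0"] that by (simp add: k_def)
      have kl: "k \<le> length y" using ex unfolding k_def by (rule Least_le)
      obtain j where j: "k = Suc j" using k by (cases k) auto
      have y: "y = take j y @ y ! j # drop k y"
        using id_take_nth_drop[of j y] j kl by simp
      have "take k y = take j y @ [y ! j]" using j kl by (simp add: take_Suc_conv_app_nth)
      then have hj: "height (take j y) = 0" "y ! j \<noteq> 1"
        using k below[of j] j by (auto split: if_splits)
      have "dyck (take j y)"
      proof -
        have "0 \<le> height p" if "take j y = p @ q" for p q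
        proof -
          have "length p \<le> j" "p = take (length p) y"
            using that by (metis append_eq_conv_conj length_append length_take min.bounded_iff le_add1)
              (metis that append_eq_conv_conj take_take min.absorb1 length_append length_take le_add1 min.bounded_iff)
          then show ?thesis using below[of "length p"] j by simp
        qed
        moreover have "length (take j y) < length x" using Cons by simp
        ultimately show ?thesis using 1 hj by blast
      qed
      moreover have "dyck (drop k y)"
      proof -
        have hx: "height x = height (drop k y)"
          using Cons c hj arg_cong[OF y, of height] by simp
        have "0 \<le> height p" if "drop k y = p @ q" for p q
        proof -
          have "x = (1 # take j y @ y ! j # p) @ q" using Cons c y that by simp
          from pre[OF this] show ?thesis using hj by simp
        qed
        moreover have "length (drop k y) < length x" using Cons by simp
        ultimately show ?thesis using 1 hx h0 by metis
      qed
      ultimately show ?thesis using dyck.Cons[of "take j y" "y ! j" "drop k y"] hj(2) y Cons c by simp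
    qed simp
  qed
qed

lemma dyck_insert: assumes "dyck (p @ q)" "dyck z" shows "dyck (p @ z @ q)"
  unfolding dyck_iff
proof (intro conjI allI impI)
  show "height (p @ z @ q) = 0" using assms by (simp add: dyck_iff)
  fix s t assume "p @ z @ q = s @ t"
  then consider r where "p = s @ r" | r r' where "s = p @ r" "z = r @ r'"
    | r where "s = p @ z @ r" "q = r @ t"
    by (fastforce simp: append_eq_append_conv2)
  then show "0 \<le> height s"
  proof cases
    case 1
    then show ?thesis using dyck_prefix_nonneg[OF assms(1), of s "r @ q"] by simp
  next
    case 2
    then show ?thesis
      using dyck_prefix_nonneg[OF assms(1), of p q] dyck_prefix_nonneg[OF assms(2), of r r'] by simp
  next
    case 3
    then show ?thesis
      using dyck_prefix_nonneg[OF assms(1), of "p @ r" t] dyck_height[OF assms(2)] by simp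
  qed
qed

text \<open>If \<open>u'\<close> were longer, it would have the prefix \<open>u @ [a]\<close>, whose
  height is -1.\<close>

lemma first_return_le:
  assumes "dyck u" "dyck u'" "a \<noteq> 1" "u @ a # v = u' @ a' # v'"
  shows "length u' \<le> length u"
proof (rule ccontr)
  assume "\<not> length u' \<le> length u"
  then obtain q where "u' = (u @ [a]) @ q"
    using assms(4) by (fastforce simp: append_eq_append_conv2 Cons_eq_append_conv)
  from dyck_prefix_nonneg[OF assms(2) this] show False
    using assms(1,3) dyck_height by simp
qed

lemma first_return_unique:
  assumes "dyck u" "dyck u'" "a \<noteq> 1" "a' \<noteq> 1" "u @ a # v = u' @ a' # v'"
  shows "u = u' \<and> a = a' \<and> v = v'"
  using first_return_le[of u u' a v a' v'] first_return_le[of u' u a' v' a v] assms by simp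

text \<open>A Dyck word followed by one letter encodes an ordered tree whose vertices are labelled by
  the letters different from 1, the root by the last letter. The following map makes the first
  child of the root the new root and keeps all vertex labels.\<close>

definition rot_tree :: "nat list \<Rightarrow> nat list" where
  "rot_tree w = (THE w'. \<exists>u a t. w = 1 # u @ a # t \<and> dyck u \<and> a \<noteq> 1 \<and> w' = u @ 1 # t @ [a])"

lemma rot_tree_eq:
  assumes "dyck u" "a \<noteq> 1"
  shows "rot_tree (1 # u @ a # t) = u @ 1 # t @ [a]"
  unfolding rot_tree_def
  by (rule the_equality) (use assms first_return_unique in \<open>blast | auto\<close>)+

text \<open>Iterating \<open>rot_tree\<close> walks around the tree. After \<open>length x\<close>
  steps the walk has gone around the subtrees coded by \<open>x\<close> and is back at the root,
  with these subtrees now behind those coded by \<open>y\<close>.\<close>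

lemma rot_tree_power_dyck:
  assumes "dyck x" "dyck y" "r \<noteq> 1"
  shows "(rot_tree ^^ length x) (x @ y @ [r]) = y @ x @ [r]"
  using assms
proof (induction arbitrary: y r rule: dyck.induct)
  case (Cons u a v)
  \<comment> \<open>One step down to the vertex \<open>a\<close>, a walk around its subtrees
    \<open>u\<close>, one step back to the root, and a walk around \<open>v\<close>.\<close>
  have 1: "rot_tree ((1 # u @ a # v) @ y @ [r]) = u @ (1 # (v @ y) @ [r]) @ [a]"
    using rot_tree_eq[of u a "v @ y @ [r]"] Cons.hyps by simp
  have 2: "(rot_tree ^^ length u) (u @ (1 # (v @ y) @ [r]) @ [a]) = (1 # (v @ y) @ [r]) @ u @ [a]"
    using Cons dyck.Cons[of "v @ y" r "[]"] by (intro Cons.IH) (auto simp: dyck_append)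
  have 3: "rot_tree ((1 # (v @ y) @ [r]) @ u @ [a]) = v @ (y @ 1 # u @ [a]) @ [r]"
    using rot_tree_eq[of "v @ y" r "u @ [a]"] Cons by (simp add: dyck_append)
  have 4: "(rot_tree ^^ length v) (v @ (y @ 1 # u @ [a]) @ [r]) = (y @ 1 # u @ [a]) @ v @ [r]"
    using Cons dyck.Cons[of u a "[]"] by (intro Cons.IH) (auto simp: dyck_append)
  have len: "length (1 # u @ a # v) = length v + (1 + (length u + 1))" by simp
  show ?case
    unfolding len funpow_add o_apply using 1 2 3 4 by simp
qed simp

text \<open>The walk along \<open>p\<close> brings the inserted subtrees \<open>z\<close> to the
  front. Since the rest \<open>v\<close> is the same for all \<open>z\<close>, replacing
  \<open>z\<close> deep inside a tree amounts to replacing it at the front.\<close>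

lemma rot_tree_power_prefix:
  assumes "p @ t = d @ [r]" "dyck d" "r \<noteq> 1" "t \<noteq> []"
  shows "\<exists>v. \<forall>z. dyck z \<longrightarrow> (rot_tree ^^ length p) (p @ z @ t) = z @ v"
  using assms
proof (induction "length p" arbitrary: p t d r)
  case 0
  then show ?case by auto
next
  case (Suc k)
  have "d \<noteq> []" using Suc.prems(1,4) Suc.hyps(2) by (auto simp: append_eq_Cons_conv)
  then obtain u a v where d: "d = 1 # u @ a # v" "dyck u" "a \<noteq> 1" "dyck v"
    using Suc.prems(2) by (auto elim: dyck.cases)
  obtain p' where p: "p = 1 # p'" using Suc d by (cases p) auto
  have eq: "p' @ t = u @ a # (v @ [r])" using Suc.prems d p by simp
  have d': "dyck (u @ 1 # v @ [r])"
    using dyck_append[OF d(2) dyck.Cons[OF d(4) Suc.prems(3) dyck.Nil]] by simp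
  have k: "k = length p'" using Suc.hyps p by simp
  \<comment> \<open>The insertion point lies among the subtrees of the first child or beyond that
    child. One step turns the prefix into \<open>p'\<close> or \<open>u @ 1 # p2\<close>, which is
    one letter shorter than \<open>p\<close>.\<close>
  consider (inside) u2 where "u = p' @ u2" "t = u2 @ a # (v @ [r])"
    | (after) p2 where "p' = u @ a # p2" "v @ [r] = p2 @ t"
    using eq Suc.prems(4) by (fastforce simp: append_eq_append_conv2 append_eq_Cons_conv Cons_eq_append_conv)
  then show ?case
  proof cases
    case inside
    have "\<exists>v'. \<forall>z. dyck z \<longrightarrow> (rot_tree ^^ length p') (p' @ z @ (u2 @ 1 # v @ [r, a])) = z @ v'"
      by (rule Suc.hyps(1)[of p' _ "u @ 1 # v @ [r]" a]) (use inside d d' k in auto)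
    then obtain v' where v':
      "\<And>z. dyck z \<Longrightarrow> (rot_tree ^^ length p') (p' @ z @ (u2 @ 1 # v @ [r, a])) = z @ v'"
      by blast
    have "(rot_tree ^^ length p) (p @ z @ t) = z @ v'" if "dyck z" for z
      using rot_tree_eq[of "p' @ z @ u2" a "v @ [r]"] dyck_insert[of p' u2 z] v'[OF that] inside d that p
      by (simp add: funpow_Suc_right del: funpow.simps)
    then show ?thesis by blast
  next
    case after
    have "\<exists>v'. \<forall>z. dyck z \<longrightarrow>
        (rot_tree ^^ length (u @ 1 # p2)) ((u @ 1 # p2) @ z @ (t @ [a])) = z @ v'"
      by (rule Suc.hyps(1)[of _ _ "u @ 1 # v @ [r]" a]) (use after d d' k in auto)
    then obtain v' where v': "\<And>z. dyck z \<Longrightarrow>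
        (rot_tree ^^ length (u @ 1 # p2)) ((u @ 1 # p2) @ z @ (t @ [a])) = z @ v'"
      by blast
    have "(rot_tree ^^ length p) (p @ z @ t) = z @ v'" if "dyck z" for z
      using rot_tree_eq[of u a "p2 @ z @ t"] v'[OF that] after d that p
      by (simp add: funpow_Suc_right del: funpow.simps)
    then show ?thesis by blast
  qed
qed

section \<open>Ordered trees with one marked vertex as words\<close>

definition words :: "nat \<Rightarrow> nat list set" where
  "words n = {w. \<exists>d r. w = d @ [r] \<and> dyck d \<and> r \<noteq> 1 \<and> length d = 2 * n \<and>
     set w \<subseteq> {1, 2, 3} \<and> count_list w 3 = 1}"

lemma length_words: "w \<in> words n \<Longrightarrow> length w = 2 * n + 1"
  by (auto simp: words_def)

lemma words_decomp:
  assumes "w \<in> words n" "0 < n"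
  obtains u a v r where "w = 1 # u @ a # v @ [r]" "dyck u" "a \<noteq> 1" "dyck v" "r \<noteq> 1"
proof -
  obtain d r where d: "w = d @ [r]" "dyck d" "r \<noteq> 1" "length d = 2 * n"
    using assms(1) by (auto simp: words_def)
  show ?thesis using d(2)
  proof (cases rule: dyck.cases)
    case Nil
    then show ?thesis using d assms by simp
  next
    case (Cons u a v)
    then show ?thesis using that d by simp
  qed
qed

lemma rot_tree_words:
  assumes "w \<in> words n" "0 < n"
  shows "rot_tree w \<in> words n"
proof -
  obtain u a v r where w: "w = 1 # u @ a # v @ [r]" "dyck u" "a \<noteq> 1" "dyck v" "r \<noteq> 1"
    using words_decomp[OF assms] .
  have "rot_tree w = (u @ 1 # v @ [r]) @ [a]" using rot_tree_eq[OF w(2,3)] w(1) by simp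
  moreover have "dyck (u @ 1 # v @ [r])"
    using dyck_append[OF w(2) dyck.Cons[OF w(4,5) dyck.Nil]] by simp
  ultimately show ?thesis using assms(1) w by (auto simp: words_def split: if_splits)
qed

lemma rot_tree_power_words:
  "w \<in> words n \<Longrightarrow> 0 < n \<Longrightarrow> (rot_tree ^^ k) w \<in> words n"
  by (induction k) (auto intro: rot_tree_words)

lemma rot_tree_period:
  assumes "w \<in> words n"
  shows "(rot_tree ^^ (2 * n)) w = w"
proof -
  obtain d r where "w = d @ [r]" "dyck d" "r \<noteq> 1" "length d = 2 * n"
    using assms by (auto simp: words_def)
  then show ?thesis using rot_tree_power_dyck[of d "[]" r] by simp
qed

text \<open>The walk around the tree closes after \<open>2 * n\<close> steps, so
  \<open>2 * n - 1\<close> further steps invert one step.\<close>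

lemma inj_on_rot_tree:
  assumes "0 < n"
  shows "inj_on rot_tree (words n)"
proof (rule inj_on_inverseI)
  fix w assume "w \<in> words n"
  then show "(rot_tree ^^ (2 * n - 1)) (rot_tree w) = w"
    using rot_tree_period[of w n] assms
    by (metis One_nat_def Suc_pred funpow_Suc_right nat_0_less_mult_iff o_apply zero_less_numeral)
qed

text \<open>The leaf that is the first child of the root's first child becomes the first child of
  the root.\<close>

lemma words_pull:
  assumes "1 # 1 # 2 # u @ 2 # v \<in> words n"
  shows "1 # 2 # 1 # u @ 2 # v \<in> words n"
proof -
  obtain d r where d: "1 # 1 # 2 # u @ 2 # v = d @ [r]" "dyck d" "r \<noteq> 1" "length d = 2 * n"
    "count_list (1 # 1 # 2 # u @ 2 # v) 3 = 1" "set (1 # 1 # 2 # u @ 2 # v) \<subseteq> {1, 2, 3}"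
    using assms unfolding words_def by blast
  obtain d' where d': "d = 1 # 1 # 2 # d'"
    using d(1) dyck_height[OF d(2)] by (auto simp: Cons_eq_append_conv append_eq_Cons_conv)
  \<comment> \<open>A nonempty prefix \<open>1 # p'\<close> has the same height as the prefix
    \<open>1 # 1 # 2 # p'\<close> of \<open>d\<close>.\<close>
  have "dyck ([1] @ d')"
    unfolding dyck_iff
  proof (intro conjI allI impI)
    show "height ([1] @ d') = 0" using dyck_height[OF d(2)] d' by simp
    fix p q assume "[1] @ d' = p @ q"
    then have "p = [] \<or> (\<exists>p'. p = 1 # p' \<and> d' = p' @ q)" by (auto simp: Cons_eq_append_conv)
    then show "0 \<le> height p"
      using dyck_prefix_nonneg[OF d(2), of "1 # 1 # 2 # tl p" q] d' by auto
  qed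
  from dyck.Cons[OF dyck.Nil _ this, of 2] have "dyck (1 # 2 # 1 # d')" by simp
  moreover have "1 # 2 # 1 # u @ 2 # v = (1 # 2 # 1 # d') @ [r]" using d(1) d' by simp
  ultimately show ?thesis using d d' by (auto simp: words_def)
qed

text \<open>The factor cut out is the subtree at a vertex labelled \<open>b\<close>, with the edge
  to its parent. In this shape \<open>rot_tree_power_prefix\<close> can bring it to the
  front.\<close>

lemma dyck_split_at_down:
  assumes "dyck d" "b \<in> set d" "b \<noteq> 1"
  shows "\<exists>p u q. d = p @ (1 # u @ [b]) @ q \<and> dyck u \<and> dyck (p @ q)"
  using assms
proof (induction rule: dyck.induct)
  case (Cons u a v)
  consider "b \<in> set u" | "b = a" | "b \<in> set v" using Cons.prems by auto
  then show ?case
  proof cases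
    case 1
    then obtain p u' q where "u = p @ (1 # u' @ [b]) @ q" "dyck u'" "dyck (p @ q)"
      using Cons by blast
    then show ?thesis using dyck.Cons[of "p @ q" a v] Cons.hyps
      by (intro exI[of _ "1 # p"] exI[of _ u'] exI[of _ "q @ a # v"]) auto
  next
    case 2
    then show ?thesis using Cons.hyps
      by (intro exI[of _ "[]"] exI[of _ u] exI[of _ v]) auto
  next
    case 3
    then obtain p u' q where "v = p @ (1 # u' @ [b]) @ q" "dyck u'" "dyck (p @ q)"
      using Cons by blast
    then show ?thesis using dyck.Cons[of u a "p @ q"] Cons.hyps
      by (intro exI[of _ "1 # u @ a # p"] exI[of _ u'] exI[of _ q]) auto
  qed
qed simp

text \<open>A tree that is not a star has a vertex below the root whose first child is a leaf. If no
  such vertex lies below the first child, the subtrees \<open>u\<close> there form a star: a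
  nonempty one makes the first child itself such a vertex, an empty one leaves the search to
  \<open>v\<close>.\<close>

lemma dyck_star_or_pull:
  assumes "dyck d" "set d \<subseteq> {1, 2}"
  shows "(\<exists>k. d = concat (replicate k [1, 2])) \<or>
    (\<exists>p u q. d = p @ (1 # 1 # 2 # u @ [2]) @ q \<and> dyck u \<and> dyck (p @ q))"
  using assms
proof (induction rule: dyck.induct)
  case Nil
  show ?case by (auto intro: exI[of _ 0])
next
  case (Cons u a v)
  have a: "a = 2" using Cons by auto
  show ?case
  proof (cases "\<exists>p u' q. u = p @ (1 # 1 # 2 # u' @ [2]) @ q \<and> dyck u' \<and> dyck (p @ q)")
    case True
    then obtain p u' q where "u = p @ (1 # 1 # 2 # u' @ [2]) @ q" "dyck u'" "dyck (p @ q)"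
      by blast
    then show ?thesis using dyck.Cons[of "p @ q" a v] Cons.hyps
      by (intro disjI2 exI[of _ "1 # p"] exI[of _ u'] exI[of _ "q @ a # v"]) auto
  next
    case False
    then obtain k where k: "u = concat (replicate k [1, 2])" using Cons by auto
    show ?thesis
    proof (cases k)
      case 0
      then have u: "u = []" using k by simp
      consider m where "v = concat (replicate m [1, 2])"
        | p u' q where "v = p @ (1 # 1 # 2 # u' @ [2]) @ q" "dyck u'" "dyck (p @ q)"
        using Cons by fastforce
      then show ?thesis
      proof cases
        case 1
        then show ?thesis using u a by (intro disjI1 exI[of _ "Suc m"]) simp
      next
        case 2
        then show ?thesis using u a dyck.Cons[of "[]" 2 "p @ q"]
          by (intro disjI2 exI[of _ "1 # 2 # p"] exI[of _ u'] exI[of _ q]) auto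
      qed
    next
      case (Suc m)
      have "u = 1 # 2 # concat (replicate m [1, 2])" using k Suc by simp
      moreover have "dyck (concat (replicate m [1, 2]))" for m
        using dyck.Cons[OF dyck.Nil, of 2] by (induction m) auto
      ultimately show ?thesis using a Cons.hyps
        by (intro disjI2 exI[of _ "[]"] exI[of _ "concat (replicate m [1, 2])"] exI[of _ v]) auto
    qed
  qed
qed

text \<open>Potential for the pull moves: the sum, over the letters 1, of the number of later letters.\<close>

fun ones_area :: "nat list \<Rightarrow> nat" where
  "ones_area [] = 0"
| "ones_area (c # xs) = (if c = 1 then length xs else 0) + ones_area xs"

lemma ones_area_append:
  "length x = length y \<Longrightarrow> ones_area x < ones_area y \<Longrightarrow> ones_area (p @ x) < ones_area (p @ y)"
  by (induction p) auto

text \<open>Rotation moves the mark to the root; then pulls lower \<open>ones_area\<close> until the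
  star remains. The relation \<open>E\<close> is abstract because it will be that of lying on one
  orbit at offset 0.\<close>

lemma words_connected:
  assumes E: "equivp E" and n: "0 < n"
    and rot: "\<And>w. w \<in> words n \<Longrightarrow> E w (rot_tree w)"
    and pull: "\<And>u v. 1 # 1 # 2 # u @ 2 # v \<in> words n \<Longrightarrow> dyck u \<Longrightarrow>
      E (1 # 1 # 2 # u @ 2 # v) (1 # 2 # 1 # u @ 2 # v)"
    and w: "w \<in> words n" and w': "w' \<in> words n"
  shows "E w w'"
proof -
  have trans: "E a c" if "E a b" "E b c" for a b c using E that by (blast elim: equivpE dest: transpD)
  have sym: "E b a" if "E a b" for a b using E that by (blast elim: equivpE dest: sympD)
  have refl: "E a a" for a using E by (blast elim: equivpE dest: reflpD)
  have pow: "E w ((rot_tree ^^ k) w)" if "w \<in> words n" for w k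
    using that by (induction k) (auto intro: refl trans rot rot_tree_power_words[OF _ n])
  have root: "\<exists>d. d @ [3] \<in> words n \<and> E w (d @ [3])" if w: "w \<in> words n" for w
  proof -
    obtain d r where d: "w = d @ [r]" "dyck d" "r \<noteq> 1" "count_list w 3 = 1"
      using w by (auto simp: words_def)
    show ?thesis
    proof (cases "r = 3")
      case True
      then show ?thesis using d w refl by auto
    next
      case False
      then have "count_list d 3 = 1" using d by simp
      then have "3 \<in> set d" by (metis count_list_0_iff zero_neq_one)
      then obtain p u q where p: "d = p @ (1 # u @ [3]) @ q" "dyck u" "dyck (p @ q)"
        using dyck_split_at_down[OF d(2), of 3] by auto
      obtain v where "(rot_tree ^^ length p) (p @ (1 # u @ [3]) @ q @ [r]) = (1 # u @ [3]) @ v"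
        using rot_tree_power_prefix[of p "q @ [r]" "p @ q" r] p d(3) dyck.Cons[OF p(2) _ dyck.Nil, of 3]
        by auto
      then have v: "(rot_tree ^^ length p) w = 1 # u @ 3 # v" using d p by simp
      have mem: "1 # u @ 3 # v \<in> words n" using rot_tree_power_words[OF w n, of "length p"] v by simp
      \<comment> \<open>The marked vertex is now the first child of the root, and one more step
        makes it the root.\<close>
      have "rot_tree (1 # u @ 3 # v) = (u @ 1 # v) @ [3]" using rot_tree_eq[OF p(2), of 3 v] by simp
      then show ?thesis
        using mem rot[OF mem] rot_tree_words[OF mem n] pow[OF w, of "length p"] v trans
        by (intro exI[of _ "u @ 1 # v"]) auto
    qed
  qed
  have star: "E (d @ [3]) (concat (replicate n [1, 2]) @ [3])" if "d @ [3] \<in> words n" for d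
    using that
  proof (induction "ones_area (d @ [3])" arbitrary: d rule: less_induct)
    case less
    have d: "dyck d" "length d = 2 * n" "set d \<subseteq> {1, 2}"
      using less.prems by (auto simp: words_def count_list_0_iff)
    consider k where "d = concat (replicate k [1, 2])"
      | p u q where "d = p @ (1 # 1 # 2 # u @ [2]) @ q" "dyck u" "dyck (p @ q)"
      using dyck_star_or_pull[OF d(1,3)] by blast
    then show ?case
    proof cases
      case 1
      then have "k = n" using d(2) by (simp add: length_concat sum_list_replicate)
      then show ?thesis using 1 refl by simp
    next
      case 2
      define d' where "d' = p @ (1 # 2 # 1 # u @ [2]) @ q"
      \<comment> \<open>Both forms of the site are Dyck words, so \<open>length p\<close> steps
        bring either one to the front, followed by the same \<open>v\<close>.\<close>
      have z: "dyck (1 # 1 # 2 # u @ [2])" "dyck (1 # 2 # 1 # u @ [2])"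
        using dyck.Cons[OF dyck.Nil, of 2] dyck.Cons[OF dyck.Cons[OF dyck.Nil _ 2(2)] _ dyck.Nil, of 2 2]
          dyck.Cons[OF 2(2) _ dyck.Nil, of 2] by auto
      have "\<exists>v. \<forall>z. dyck z \<longrightarrow> (rot_tree ^^ length p) (p @ z @ (q @ [3])) = z @ v"
        by (rule rot_tree_power_prefix[of p "q @ [3]" "p @ q" 3]) (use 2 in auto)
      then obtain v where v:
        "\<And>z. dyck z \<Longrightarrow> (rot_tree ^^ length p) (p @ z @ (q @ [3])) = z @ v" by blast
      have v1: "(rot_tree ^^ length p) (d @ [3]) = 1 # 1 # 2 # u @ 2 # v" using v[OF z(1)] 2 by simp
      have v2: "(rot_tree ^^ length p) (d' @ [3]) = 1 # 2 # 1 # u @ 2 # v"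
        using v[OF z(2)] d'_def by simp
      have mem: "1 # 1 # 2 # u @ 2 # v \<in> words n"
        using rot_tree_power_words[OF less.prems n, of "length p"] v1 by simp
      have "dyck d'" using dyck_insert[OF 2(3) z(2)] d'_def by simp
      then have d'w: "d' @ [3] \<in> words n" using less.prems d 2(1) d'_def by (auto simp: words_def)
      \<comment> \<open>The pull moves a single letter 1 one place to the right.\<close>
      have "ones_area (d' @ [3]) < ones_area (d @ [3])"
        using ones_area_append[of "(1 # 2 # 1 # u @ [2]) @ q @ [3]" "(1 # 1 # 2 # u @ [2]) @ q @ [3]" p]
          2(1) d'_def by simp
      from less.hyps[OF this d'w] have "E (d' @ [3]) (concat (replicate n [1, 2]) @ [3])" .
      moreover have "E (d @ [3]) (1 # 1 # 2 # u @ 2 # v)"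
        using pow[OF less.prems, of "length p"] v1 by simp
      moreover have "E (1 # 2 # 1 # u @ 2 # v) (d' @ [3])"
        using pow[OF d'w, of "length p"] v2 sym by simp
      ultimately show ?thesis using pull[OF mem 2(2)] trans by blast
    qed
  qed
  obtain d d' where "d @ [3] \<in> words n" "E w (d @ [3])" "d' @ [3] \<in> words n" "E w' (d' @ [3])"
    using root[OF w] root[OF w'] by blast
  then show ?thesis using trans[OF _ star] trans[OF _ sym[OF trans[OF _ star]]] by blast
qed

subsection \<open>Merging two orbits of a permutation\<close>

text \<open>Lying on a common orbit. In the closure form, orbits of two maps can be compared by
  checking single steps, through \<open>step_eq_least\<close>.\<close>

definition step_eq :: "'a set \<Rightarrow> ('a \<Rightarrow> 'a) \<Rightarrow> 'a \<Rightarrow> 'a \<Rightarrow> bool" where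
  "step_eq V f = equivclp (\<lambda>a b. a \<in> V \<and> b = f a)"

lemma equivp_step_eq: "equivp (step_eq V f)"
  by (simp add: step_eq_def)

lemma step_eq_refl: "step_eq V f a a"
  by (simp add: step_eq_def)

lemma step_eq_sym: "step_eq V f a b \<Longrightarrow> step_eq V f b a"
  unfolding step_eq_def by (rule equivclp_sym)

lemma step_eq_trans [trans]: "step_eq V f a b \<Longrightarrow> step_eq V f b c \<Longrightarrow> step_eq V f a c"
  unfolding step_eq_def by (rule equivclp_trans)

lemma step_eq_step: "a \<in> V \<Longrightarrow> step_eq V f a (f a)"
  unfolding step_eq_def by (rule r_into_equivclp) simp

lemma step_eq_least:
  assumes "step_eq V f a b" "equivp E" "\<And>a. a \<in> V \<Longrightarrow> E a (f a)"
  shows "E a b"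
  using assms(1) unfolding step_eq_def
proof (induction rule: equivclp_induct)
  case base
  then show ?case using assms(2) by (blast elim: equivpE dest: reflpD)
next
  case (step b c)
  then show ?case using assms(2,3) by (blast elim: equivpE dest: sympD transpD)
qed

lemma funpow_in: "f ` V \<subseteq> V \<Longrightarrow> a \<in> V \<Longrightarrow> (f ^^ k) a \<in> V"
  by (induction k) auto

lemma funpow_cancel:
  assumes "inj_on f V" "f ` V \<subseteq> V" "a \<in> V" "(f ^^ i) a = (f ^^ j) a" "i \<le> j"
  shows "(f ^^ (j - i)) a = a"
  using assms(4,5)
proof (induction i arbitrary: j)
  case (Suc i)
  then obtain j' where j: "j = Suc j'" by (cases j) auto
  then have "(f ^^ i) a = (f ^^ j') a"
    using Suc.prems assms(1) funpow_in[OF assms(2,3)] by (auto dest: inj_onD)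
  then show ?case using Suc j by simp
qed simp

lemma funpow_returns:
  assumes "finite V" "inj_on f V" "f ` V \<subseteq> V" "a \<in> V"
  obtains k where "0 < k" "(f ^^ k) a = a"
proof -
  have "\<not> inj (\<lambda>k. (f ^^ k) a)"
    using finite_subset[OF _ assms(1), of "range (\<lambda>k. (f ^^ k) a)"] funpow_in[OF assms(3,4)]
      range_inj_infinite by blast
  then obtain i j where "i < j" "(f ^^ i) a = (f ^^ j) a"
    unfolding inj_def by (metis linorder_neqE_nat)
  then show thesis using that[of "j - i"] funpow_cancel[OF assms(2-4), of i j] by simp
qed

text \<open>Every orbit returns to its start, so a step backwards is a number of steps
  forwards.\<close>

lemma step_eq_reach:
  assumes "finite V" "inj_on f V" "f ` V \<subseteq> V" "a \<in> V" "step_eq V f a b"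
  shows "\<exists>k. b = (f ^^ k) a"
  using assms(5) unfolding step_eq_def
proof (induction rule: equivclp_induct)
  case base
  show ?case by (intro exI[of _ 0]) simp
next
  case (step b c)
  then obtain k where k: "b = (f ^^ k) a" by blast
  show ?case
  proof (cases "b \<in> V \<and> c = f b")
    case True
    then show ?thesis using k by (intro exI[of _ "Suc k"]) simp
  next
    case False
    then have c: "c \<in> V" "b = f c" using step by auto
    obtain m where m: "0 < m" "(f ^^ m) c = c" using funpow_returns[OF assms(1-3) c(1)] .
    have "c = (f ^^ (m - 1)) b"
      using m c(2) by (metis Suc_diff_1 funpow_Suc_right o_apply)
    then show ?thesis using k by (intro exI[of _ "m - 1 + k"]) (simp add: funpow_add)
  qed
qed

text \<open>The new permutation leaves \<open>x\<close> for the cycle of \<open>y\<close>, runs through it once, and then traverses the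
  segment from \<open>x'\<close> to \<open>p'\<close> backwards before it continues with \<open>z\<close>.\<close>

lemma merge_orbits:
  fixes f :: "'a \<Rightarrow> 'a"
  assumes V: "finite V" "inj_on f V" "f ` V \<subseteq> V"
    and path: "f x = x'" "f x' = x1" "f x1 = x1'" "f x1' = p" "f p = p'" "f p' = z"
    and mem: "x \<in> V" "y \<in> V" and sep: "\<not> step_eq V f x y"
    and dist: "distinct [x, x', x1, x1', p, p']"
  defines "g \<equiv> f(x := f y, y := p', p' := p, p := x1', x1' := x1, x1 := x', x' := z)"
  shows "inj_on g V" "g ` V \<subseteq> V" "step_eq V f a b \<Longrightarrow> step_eq V g a b" "step_eq V g x y"
proof -
  let ?P = "{x, x', x1, x1', p, p'}"
  have fV: "f c \<in> V" if "c \<in> V" for c using V(3) that by blast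
  have inV: "?P \<subseteq> V" "z \<in> V" "f y \<in> V" unfolding path[symmetric] by (simp_all add: fV mem)
  have Px: "step_eq V f x c" if "c \<in> ?P" for c
  proof -
    have st: "step_eq V f x (f c)" if "step_eq V f x c" "c \<in> V" for c
      using that(1) step_eq_step[OF that(2)] by (rule step_eq_trans)
    have "step_eq V f x x'" using st[OF step_eq_refl mem(1)] path(1) by simp
    moreover from st[OF this] have "step_eq V f x x1" using inV(1) path(2) by simp
    moreover from st[OF this] have "step_eq V f x x1'" using inV(1) path(3) by simp
    moreover from st[OF this] have "step_eq V f x p" using inV(1) path(4) by simp
    moreover from st[OF this] have "step_eq V f x p'" using inV(1) path(5) by simp
    ultimately show ?thesis using that step_eq_refl by auto
  qed
  then have y: "y \<notin> ?P" using sep by blast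
  have g: "g x = f y" "g y = p'" "g p' = p" "g p = x1'" "g x1' = x1" "g x1 = x'" "g x' = z"
    "\<And>c. c \<notin> insert y ?P \<Longrightarrow> g c = f c"
    using dist y by (auto simp: g_def)
  show gV: "g ` V \<subseteq> V" using V(3) inV mem by (auto simp: g_def)
  \<comment> \<open>Both maps send the set of changed points onto the same set. So \<open>g\<close>
    has the same image as \<open>f\<close>, and injectivity follows by counting.\<close>
  have "f ` insert y ?P = insert (f y) {x', x1, x1', p, p', z}" using path by auto
  moreover have "g ` insert y ?P = insert (f y) {x', x1, x1', p, p', z}" using g(1-7) by auto
  moreover have "g ` (V - insert y ?P) = f ` (V - insert y ?P)" using g(8) by (intro image_cong) auto
  moreover have "V = insert y ?P \<union> (V - insert y ?P)" using inV mem by auto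
  ultimately have "g ` V = f ` V" by (metis image_Un)
  then have "card (g ` V) = card V" using V card_image by metis
  then show "inj_on g V" using V(1) by (rule eq_card_imp_inj_on[rotated])
  have step: "step_eq V g c (g c)" if "c \<in> V" for c using that by (rule step_eq_step)
  \<comment> \<open>From \<open>x\<close>, the map \<open>g\<close> enters the old orbit of
    \<open>y\<close> at \<open>f y\<close> and follows it. Where the orbit passes \<open>y\<close>,
    the next point \<open>f y\<close> is reached directly from \<open>x\<close>.\<close>
  have around: "step_eq V g x ((f ^^ Suc i) y)" for i
  proof (induction i)
    case 0
    then show ?case using step[OF mem(1)] g(1) by simp
  next
    case (Suc i)
    let ?c = "(f ^^ Suc i) y"
    have cV: "?c \<in> V" using funpow_in[OF V(3) mem(2)] .
    have orbit: "step_eq V f y ((f ^^ j) y)" for j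
    proof (induction j)
      case (Suc j)
      then show ?case
        using step_eq_trans[OF _ step_eq_step[OF funpow_in[OF V(3) mem(2), of j]]] by simp
    qed (simp add: step_eq_refl)
    have "?c \<notin> ?P"
    proof
      assume "?c \<in> ?P"
      then have "step_eq V f x ?c" by (rule Px)
      then have "step_eq V f x y" using orbit[of "Suc i"] by (rule step_eq_trans[OF _ step_eq_sym])
      then show False using sep by simp
    qed
    show ?case
    proof (cases "?c = y")
      case True
      then have "(f ^^ Suc (Suc i)) y = f y" by simp
      then show ?thesis using step[OF mem(1)] g(1) by simp
    next
      case False
      then have "g ?c = f ?c" using g(8) \<open>?c \<notin> ?P\<close> by blast
      then have "step_eq V g ?c ((f ^^ Suc (Suc i)) y)" using step[OF cV] by simp
      then show ?thesis by (rule step_eq_trans[OF Suc])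
    qed
  qed
  obtain k where k: "0 < k" "(f ^^ k) y = y" using funpow_returns[OF V mem(2)] .
  then show xy: "step_eq V g x y" using around[of "k - 1"] by simp
  have chain: "step_eq V g y p'" "step_eq V g p' p" "step_eq V g p x1'" "step_eq V g x1' x1"
    "step_eq V g x1 x'" "step_eq V g x' z"
    using step[of y] step[of p'] step[of p] step[of x1'] step[of x1] step[of x'] mem(2) inV(1) g(2-7)
    by simp_all
  have xall: "step_eq V g x c" if "c \<in> {y, p', p, x1', x1, x', z, x}" for c
  proof -
    have a: "step_eq V g x p'" using xy chain(1) by (rule step_eq_trans)
    have b: "step_eq V g x p" using a chain(2) by (rule step_eq_trans)
    have c: "step_eq V g x x1'" using b chain(3) by (rule step_eq_trans)
    have d: "step_eq V g x x1" using c chain(4) by (rule step_eq_trans)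
    have e: "step_eq V g x x'" using d chain(5) by (rule step_eq_trans)
    have f: "step_eq V g x z" using e chain(6) by (rule step_eq_trans)
    show ?thesis using a b c d e f xy step_eq_refl that by auto
  qed
  \<comment> \<open>At a changed point, both \<open>c\<close> and \<open>f c\<close> are joined to
    \<open>x\<close> under \<open>g\<close>; elsewhere \<open>f\<close> and \<open>g\<close>
    agree.\<close>
  have "step_eq V g c (f c)" if "c \<in> V" for c
  proof (cases "c \<in> insert y ?P")
    case True
    then have "step_eq V g x c" using xall by auto
    moreover have "step_eq V g x (f c)" using True xall path around[of 0] by auto
    ultimately show ?thesis by (rule step_eq_trans[OF step_eq_sym])
  next
    case False
    then show ?thesis using step[OF that] g(8) by simp
  qed
  then show "step_eq V g a b" if "step_eq V f a b"
    using step_eq_least[OF that equivp_step_eq] by blast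
qed

subsection \<open>Strings as rotated trees\<close>

text \<open>This is the cut of the cycle lemma. The cut found in the tail is extended by
  \<open>c\<close> if it then goes below 0; otherwise the empty prefix is the first lowest
  one.\<close>

lemma leftmost_lowest_prefix:
  "\<exists>p q. x = p @ q \<and>
    (\<forall>p' q'. x = p' @ q' \<longrightarrow> height p \<le> height p' \<and> (length p' < length p \<longrightarrow> height p < height p'))"
proof (induction x)
  case (Cons c x)
  then obtain p q where pq: "x = p @ q" and low: "\<And>p' q'. x = p' @ q' \<Longrightarrow>
      height p \<le> height p' \<and> (length p' < length p \<longrightarrow> height p < height p')"
    by blast
  have split: "p' = [] \<or> (\<exists>s. p' = c # s \<and> x = s @ q')" if "c # x = p' @ q'" for p' q'
    using that by (auto simp: Cons_eq_append_conv)
  show ?case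
  proof (cases "height (c # p) < 0")
    case True
    have low': "height (c # p) \<le> height p' \<and> (length p' < length (c # p) \<longrightarrow> height (c # p) < height p')"
      if "c # x = p' @ q'" for p' q'
      using split[OF that] low[of "tl p'" q'] True by auto
    show ?thesis
      by (rule exI[of _ "c # p"], rule exI[of _ q], rule conjI)
        (simp add: pq, intro allI impI, rule low')
  next
    case False
    have low': "height [] \<le> height p' \<and> (length p' < length [] \<longrightarrow> height [] < height p')"
      if "c # x = p' @ q'" for p' q'
      using split[OF that] low[of "tl p'" q'] False by auto
    show ?thesis
      by (rule exI[of _ "[]"], rule exI[of _ "c # x"], rule conjI)
        (simp, intro allI impI, rule low')
  qed
qed auto

lemma rightmost_lowest_prefix:
  "\<exists>p q. x = p @ q \<and>
    (\<forall>p' q'. x = p' @ q' \<longrightarrow> height p \<le> height p' \<and> (length p < length p' \<longrightarrow> height p < height p'))"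
proof (induction x)
  case (Cons c x)
  then obtain p q where pq: "x = p @ q" and low: "\<And>p' q'. x = p' @ q' \<Longrightarrow>
      height p \<le> height p' \<and> (length p < length p' \<longrightarrow> height p < height p')"
    by blast
  have split: "p' = [] \<or> (\<exists>s. p' = c # s \<and> x = s @ q')" if "c # x = p' @ q'" for p' q'
    using that by (auto simp: Cons_eq_append_conv)
  show ?case
  \<comment> \<open>The comparison is not strict because ties now go to the longer prefix.\<close>
  proof (cases "height (c # p) \<le> 0")
    case True
    have low': "height (c # p) \<le> height p' \<and> (length (c # p) < length p' \<longrightarrow> height (c # p) < height p')"
      if "c # x = p' @ q'" for p' q'
      using split[OF that] low[of "tl p'" q'] True by auto
    show ?thesis
      by (rule exI[of _ "c # p"], rule exI[of _ q], rule conjI)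
        (simp add: pq, intro allI impI, rule low')
  next
    case False
    have low': "height [] \<le> height p' \<and> (length [] < length p' \<longrightarrow> height [] < height p')"
      if "c # x = p' @ q'" for p' q'
      using split[OF that] low[of "tl p'" q'] False by auto
    show ?thesis
      by (rule exI[of _ "[]"], rule exI[of _ "c # x"], rule conjI)
        (simp, intro allI impI, rule low')
  qed
qed auto

text \<open>Existence in the cycle lemma: the cut comes after the first lowest prefix
  \<open>p\<close>, whose last letter is a down step and becomes \<open>r\<close>.\<close>

lemma rotation_dyck_down:
  assumes "height x = -1"
  obtains p q d r where "x = p @ q" "q @ p = d @ [r]" "dyck d" "r \<noteq> 1"
proof -
  obtain p q where pq: "x = p @ q" and lowest: "\<forall>p' q'. x = p' @ q' \<longrightarrow>
      height p \<le> height p' \<and> (length p' < length p \<longrightarrow> height p < height p')"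
    using leftmost_lowest_prefix[of x] by (elim exE conjE) (rule that)
  note low = lowest[rule_format]
  have "height p \<le> -1" using low[of x "[]"] assms by simp
  then obtain p0 r where p: "p = p0 @ [r]" by (cases p rule: rev_cases) auto
  \<comment> \<open>Up to the end of \<open>q\<close>, the prefix \<open>p @ t\<close> of
    \<open>x\<close> is not lower than \<open>p\<close>. Beyond it, the proper prefix
    \<open>s\<close> of \<open>p\<close> is strictly higher than \<open>p\<close>, which makes up
    for the total height -1.\<close>
  have pre: "0 \<le> height t" if "q @ p0 = t @ t'" for t t'
  proof -
    consider s where "q = t @ s" | s where "t = q @ s" "p0 = s @ t'"
      using \<open>q @ p0 = t @ t'\<close> by (auto simp: append_eq_append_conv2)
    then show ?thesis
    proof cases
      case 1
      then show ?thesis using low[of "p @ t" s] pq by simp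
    next
      case 2
      then show ?thesis using low[of s "t' @ [r] @ q"] pq p assms by simp
    qed
  qed
  have "0 \<le> height (q @ p0)" using pre[of "q @ p0" "[]"] by simp
  moreover have "height (q @ p0) + height [r] = -1" using pq p assms by simp
  ultimately have "height (q @ p0) = 0" "r \<noteq> 1" by (auto split: if_splits)
  then show thesis using that[of p q "q @ p0" r] pq p pre by (auto simp: dyck_iff)
qed

text \<open>After a cut behind the last lowest prefix, every nonempty prefix has positive height, so
  the word is 1 followed by a Dyck word.\<close>

lemma rotation_dyck_up:
  assumes "height x = 1"
  obtains p q d where "x = p @ q" "q @ p = 1 # d" "dyck d"
proof -
  obtain p q where pq: "x = p @ q" and lowest: "\<forall>p' q'. x = p' @ q' \<longrightarrow>
      height p \<le> height p' \<and> (length p < length p' \<longrightarrow> height p < height p')"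
    using rightmost_lowest_prefix[of x] by (elim exE conjE) (rule that)
  note low = lowest[rule_format]
  have "height p \<le> 0" using low[of "[]" x] by simp
  then obtain c q0 where q: "q = c # q0" using pq assms by (cases q) auto
  have pre: "0 < height t" if "q @ p = t @ t'" "t \<noteq> []" for t t'
  proof -
    consider s where "q = t @ s" | s where "t = q @ s" "p = s @ t'"
      using \<open>q @ p = t @ t'\<close> by (auto simp: append_eq_append_conv2)
    then show ?thesis
    proof cases
      case 1
      then show ?thesis using low[of "p @ t" s] pq \<open>t \<noteq> []\<close> by simp
    next
      case 2
      then show ?thesis using low[of s "t' @ q"] pq assms by simp
    qed
  qed
  have c: "c = 1" using pre[of "[c]" "q0 @ p"] q by (auto split: if_splits)
  have "height (q0 @ p) = 0" using pq q c assms by simp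
  moreover have "0 \<le> height s" if "q0 @ p = s @ s'" for s s'
    using pre[of "1 # s" s'] that q c by simp
  ultimately show thesis using that[of p q "q0 @ p"] pq q c by (auto simp: dyck_iff)
qed

lemma rotate_splitE:
  obtains p q where "x = p @ q" "rotate s x = q @ p"
  using rotate_drop_take[of s x] append_take_drop_id by metis

lemma height_rotate [simp]: "height (rotate s x) = height x"
  by (rule rotate_splitE[of x s]) simp

lemma count_list_rotate [simp]: "count_list (rotate s x) c = count_list x c"
  by (rule rotate_splitE[of x s]) simp

text \<open>Uniqueness in the cycle lemma: \<open>y\<close> is a rotation of \<open>x\<close>, and
  the last premise leaves only the trivial one.\<close>

lemma rotate_cancel:
  assumes eq: "rotate s x = rotate t y" and len: "length x = m" "length y = m"
    and st: "s < m" "t < m" and nosplit: "\<And>p q. x = p @ q \<Longrightarrow> y = q @ p \<Longrightarrow> p = [] \<or> q = []"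
  shows "s = t \<and> x = y"
proof -
  \<comment> \<open>This is \<open>s - t\<close> modulo \<open>m\<close>, kept within the natural
    numbers.\<close>
  let ?k = "(m - t + s) mod m"
  have "rotate (m - t + s) x = rotate (m - t) (rotate t y)"
    by (simp add: rotate_rotate[symmetric] eq)
  also have "\<dots> = y" using st len by (simp add: rotate_rotate)
  finally have y: "y = drop ?k x @ take ?k x" using len by (simp add: rotate_drop_take)
  have "?k < m" using st by simp
  then have "drop ?k x \<noteq> []" using len by simp
  then have "take ?k x = []" using nosplit[OF append_take_drop_id[symmetric] y] by blast
  then have k: "?k = 0" using len st by auto
  have "s = t"
  proof (cases "t \<le> s")
    case True
    then have "m - t + s = s - t + m" using st by simp
    moreover have "(s - t + m) mod m = s - t" using st by simp
    ultimately have "?k = s - t" by (simp only:)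
    then show ?thesis using k True by simp
  next
    case False
    then have "?k = m - t + s" using st by (intro mod_less) simp
    then show ?thesis using k st by simp
  qed
  then show ?thesis using y k by simp
qed

text \<open>The flag is true for the strings that do not start with 1. The rotation offset is to the left, so a
  double step decreases it by one; below this is written as adding \<open>2 * n\<close> modulo \<open>2 * n + 1\<close>.\<close>

fun string_of :: "bool \<times> nat \<times> nat list \<Rightarrow> nat list" where
  "string_of (False, s, w) = 1 # rotate s w"
| "string_of (True, s, w) = last w # rotate s (1 # butlast w)"

definition states :: "nat \<Rightarrow> (bool \<times> nat \<times> nat list) set" where
  "states n = UNIV \<times> {..<2 * n + 1} \<times> words n"

lemma finite_words: "finite (words n)"
proof -
  have "words n \<subseteq> {w. set w \<subseteq> {1, 2, 3} \<and> length w = 2 * n + 1}"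
    by (auto simp: words_def)
  then show ?thesis using finite_lists_length_eq[of "{1, 2, 3 :: nat}"] finite_subset by blast
qed

lemma finite_states: "finite (states n)"
  by (simp add: states_def finite_words finite_cartesian_product)

lemma length_eq_counts:
  "set x \<subseteq> {1, 2, 3} \<Longrightarrow> length x = count_list x 1 + count_list x 2 + count_list x (3 :: nat)"
  by (induction x) auto

lemma height_eq_count: "height x = 2 * int (count_list x 1) - int (length x)"
  by (induction x) auto

text \<open>Height 0 says that half of the letters are 1. With a single 3, the number of letters 2
  then follows from the length.\<close>

lemma multiset_strings_iff:
  "x \<in> multiset_strings [n + 1, n, 1] \<longleftrightarrow>
    set x \<subseteq> {1, 2, 3} \<and> length x = 2 * n + 2 \<and> height x = 0 \<and> count_list x 3 = 1"
proof -
  have "{1..length [n + 1, n, 1]} = {1, 2, 3 :: nat}" by auto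
  then have "x \<in> multiset_strings [n + 1, n, 1] \<longleftrightarrow> length x = 2 * n + 2 \<and> set x \<subseteq> {1, 2, 3} \<and>
      count_list x 1 = n + 1 \<and> count_list x 2 = n \<and> count_list x 3 = 1"
    unfolding multiset_strings_def by (simp add: mult_2)
  also have "\<dots> \<longleftrightarrow> set x \<subseteq> {1, 2, 3} \<and> length x = 2 * n + 2 \<and> height x = 0 \<and> count_list x 3 = 1"
    using length_eq_counts[of x] height_eq_count[of x] by linarith
  finally show ?thesis .
qed

lemma string_of_in:
  assumes "v \<in> states n"
  shows "string_of v \<in> multiset_strings [n + 1, n, 1]"
proof -
  obtain b s w where v: "v = (b, s, w)" by (metis prod_cases3)
  then obtain d r where w: "w = d @ [r]" "dyck d" "r \<noteq> 1" "length d = 2 * n"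
    "set (d @ [r]) \<subseteq> {1, 2, 3}" "count_list (d @ [r]) 3 = 1"
    using assms unfolding states_def words_def by blast
  show ?thesis
    unfolding multiset_strings_iff
    using w v dyck_height[OF w(2)] by (cases b) (simp_all split: if_splits)
qed

lemma inj_on_string_of: "inj_on string_of (states n)"
proof (rule inj_onI)
  fix v v' assume v: "v \<in> states n" "v' \<in> states n" and eq: "string_of v = string_of v'"
  obtain b s w b' s' w' where vw: "v = (b, s, w)" "v' = (b', s', w')" by (metis prod_cases3)
  obtain d r where w: "w = d @ [r]" "dyck d" "r \<noteq> 1" "length d = 2 * n"
    using v(1) vw by (auto simp: states_def words_def)
  obtain d' r' where w': "w' = d' @ [r']" "dyck d'" "r' \<noteq> 1" "length d' = 2 * n"
    using v(2) vw by (auto simp: states_def words_def)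
  have s: "s < 2 * n + 1" "s' < 2 * n + 1" using v vw by (auto simp: states_def)
  have "b = b'" using eq vw w w' by (cases b; cases b') auto
  show "v = v'"
  proof (cases b)
    case False
    have "s = s' \<and> w = w'"
    proof (rule rotate_cancel[OF _ _ _ s])
      show "rotate s w = rotate s' w'" using eq vw False \<open>b = b'\<close> by simp
      fix p q assume pq: "w = p @ q" "w' = q @ p"
      show "p = [] \<or> q = []"
      proof (rule ccontr)
        assume "\<not> (p = [] \<or> q = [])"
        \<comment> \<open>Both pieces are prefixes of Dyck words, hence of nonnegative height,
          against the total -1.\<close>
        then have "d = p @ butlast q" "d' = q @ butlast p"
          using pq w(1) w'(1) by (metis butlast_append butlast_snoc)+
        then have "0 \<le> height p" "0 \<le> height q"
          using dyck_prefix_nonneg w(2) w'(2) by blast+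
        moreover have "height p + height q = -1"
          using arg_cong[OF pq(1), of height] w dyck_height by simp
        ultimately show False by simp
      qed
    qed (use w w' in auto)
    then show ?thesis using vw \<open>b = b'\<close> by simp
  next
    case True
    have "s = s' \<and> 1 # d = 1 # d'"
    proof (rule rotate_cancel[OF _ _ _ s])
      show "rotate s (1 # d) = rotate s' (1 # d')" using eq vw w w' True \<open>b = b'\<close> by simp
      fix p q assume pq: "1 # d = p @ q" "1 # d' = q @ p"
      show "p = [] \<or> q = []"
      proof (rule ccontr)
        assume "\<not> (p = [] \<or> q = [])"
        \<comment> \<open>Each piece is 1 followed by a prefix of a Dyck word, hence of positive
          height, against the total 1.\<close>
        then obtain p0 q0 where "p = 1 # p0" "q = 1 # q0" "d = p0 @ q" "d' = q0 @ p"
          using pq by (auto simp: Cons_eq_append_conv)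
        then have "0 < height p" "0 < height q"
          using dyck_prefix_nonneg[OF w(2), of p0 q] dyck_prefix_nonneg[OF w'(2), of q0 p] by auto
        moreover have "height p + height q = 1"
          using arg_cong[OF pq(1), of height] w dyck_height by simp
        ultimately show False by simp
      qed
    qed (use w w' in auto)
    moreover have "r = r'" using eq vw w w' True \<open>b = b'\<close> by simp
    ultimately show ?thesis using vw w w' \<open>b = b'\<close> by simp
  qed
qed

lemma bij_betw_string_of: "bij_betw string_of (states n) (multiset_strings [n + 1, n, 1])"
  unfolding bij_betw_def
proof (intro conjI inj_on_string_of subset_antisym subsetI)
  show "x \<in> multiset_strings [n + 1, n, 1]" if "x \<in> string_of ` states n" for x
    using that string_of_in by blast
  fix x assume "x \<in> multiset_strings [n + 1, n, 1]"
  then have x: "set x \<subseteq> {1, 2, 3}" "length x = 2 * n + 2" "height x = 0" "count_list x 3 = 1"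
    by (simp_all only: multiset_strings_iff)
  then obtain c y where cy: "x = c # y" by (cases x) auto
  \<comment> \<open>The reduction of the offset matters when \<open>p\<close> is empty, since then
    \<open>q\<close> has the full length \<open>2 * n + 1\<close>.\<close>
  have rot: "rotate (length q mod (2 * n + 1)) (q @ p) = p @ q" if "y = p @ q" for p q
  proof -
    have "length (q @ p) = 2 * n + 1" using that x(2) cy by simp
    then show ?thesis using rotate_append[of q p] rotate_conv_mod[of "length q" "q @ p"] by metis
  qed
  show "x \<in> string_of ` states n"
  proof (cases "c = 1")
    case True
    then have "height y = -1" using x cy by simp
    then obtain p q d r where pq: "y = p @ q" "q @ p = d @ [r]" "dyck d" "r \<noteq> 1"
      by (rule rotation_dyck_down)
    have "length (q @ p) = 2 * n + 1" "set (q @ p) \<subseteq> {1, 2, 3}" "count_list (q @ p) 3 = 1"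
      using x cy pq(1) True by (auto split: if_splits)
    then have "q @ p \<in> words n"
      unfolding words_def using pq by (intro CollectI exI[of _ d] exI[of _ r]) auto
    then have "(False, length q mod (2 * n + 1), q @ p) \<in> states n" by (simp add: states_def)
    moreover have "string_of (False, length q mod (2 * n + 1), q @ p) = x"
      using rot[OF pq(1)] pq(1) cy True by simp
    ultimately show ?thesis by (metis imageI)
  next
    case False
    then have "height y = 1" using x cy by simp
    then obtain p q d where pq: "y = p @ q" "q @ p = 1 # d" "dyck d"
      by (rule rotation_dyck_up)
    have "length (q @ p) = 2 * n + 1" "set (q @ p) \<subseteq> {1, 2, 3}"
      "count_list (c # q @ p) 3 = 1" "c \<in> {1, 2, 3}"
      using x cy pq(1) by (auto split: if_splits)
    then have "d @ [c] \<in> words n"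
      unfolding words_def using pq False by (intro CollectI exI[of _ d] exI[of _ c]) (auto split: if_splits)
    then have "(True, length q mod (2 * n + 1), d @ [c]) \<in> states n" by (simp add: states_def)
    moreover have "string_of (True, length q mod (2 * n + 1), d @ [c]) = x"
      using rot[OF pq(1)] pq cy by simp
    ultimately show ?thesis by (metis imageI)
  qed
qed

section \<open>Star transpositions and the 2-factor of double steps\<close>

definition star_adj :: "nat list \<Rightarrow> nat list \<Rightarrow> bool" where
  "star_adj x y \<longleftrightarrow> (\<exists>c p d q. x = c # p @ d # q \<and> y = d # p @ c # q \<and> c \<noteq> d)"

lemma star_adj_sym: "star_adj x y \<Longrightarrow> star_adj y x"
  unfolding star_adj_def by blast

lemma star_adj_arc:
  assumes "star_adj x y" "x \<in> multiset_strings a" "y \<in> multiset_strings a"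
  shows "(x, y) \<in> parcs (star_transposition_graph a)"
proof -
  obtain c p d q where "x = c # p @ d # q" "y = d # p @ c # q" "c \<noteq> d"
    using assms(1) by (auto simp: star_adj_def)
  then have "1 \<le> Suc (length p) \<and> Suc (length p) < length x \<and> x ! Suc (length p) \<noteq> x ! 0 \<and>
      y = x[0 := x ! Suc (length p), Suc (length p) := x ! 0]"
    by (simp add: nth_append)
  then show ?thesis using assms(2,3) unfolding star_transposition_graph_def by auto
qed

lemma star_adj_rotate:
  assumes "c \<noteq> d"
  shows "star_adj (c # rotate s (p @ d # q)) (d # rotate s (p @ c # q))"
proof -
  have "\<exists>p' q'. rotate s (p @ d # q) = p' @ d # q' \<and> rotate s (p @ c # q) = p' @ c # q'"
  proof (induction s)
    case 0
    show ?case by auto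
  next
    case (Suc s)
    then obtain p' q' where
      "rotate s (p @ d # q) = p' @ d # q'" "rotate s (p @ c # q) = p' @ c # q'"
      by blast
    then show ?case
      by (cases p') (auto intro: exI[of _ q'] exI[of _ "[]"])
  qed
  then show ?thesis using assms by (fastforce simp: star_adj_def)
qed

text \<open>The two halves of a double step: the leading 1 is swapped with the partner of the first
  letter of \<open>w\<close>; then the new leading letter, now the root label, is swapped with that
  first 1, which shifts the offset.\<close>

fun step :: "nat \<Rightarrow> bool \<times> nat \<times> nat list \<Rightarrow> bool \<times> nat \<times> nat list" where
  "step n (False, s, w) = (True, s, rot_tree w)"
| "step n (True, s, w) = (False, (s + 2 * n) mod (2 * n + 1), w)"

lemma shift_mod: "(s :: nat) < 2 * n + 1 \<Longrightarrow> (s + 2 * n) mod (2 * n + 1) = (if s = 0 then 2 * n else s - 1)"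
proof (cases s)
  case (Suc m)
  assume "s < 2 * n + 1"
  then have "m mod (2 * n + 1) = m" using Suc by simp
  moreover have "s + 2 * n = m + (2 * n + 1)" using Suc by simp
  ultimately show ?thesis using Suc mod_add_self2[of m "2 * n + 1"] by simp
qed simp

lemma step_in: "0 < n \<Longrightarrow> v \<in> states n \<Longrightarrow> step n v \<in> states n"
  by (cases v rule: string_of.cases) (auto simp: states_def rot_tree_words)

lemma inj_on_step:
  assumes "0 < n"
  shows "inj_on (step n) (states n)"
proof (rule inj_onI)
  fix v v' assume v: "v \<in> states n" "v' \<in> states n" "step n v = step n v'"
  obtain b s w b' s' w' where vw: "v = (b, s, w)" "v' = (b', s', w')" by (metis prod_cases3)
  show "v = v'"
  proof (cases b)
    case False
    then show ?thesis
      using v vw inj_onD[OF inj_on_rot_tree[OF assms], of w w'] by (cases b') (auto simp: states_def)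
  next
    case True
    then show ?thesis
      using v vw shift_mod[of s n] shift_mod[of s' n]
      by (cases b') (auto simp: states_def split: if_splits)
  qed
qed

lemma step_adj:
  assumes "0 < n" "v \<in> states n"
  shows "star_adj (string_of v) (string_of (step n v))"
proof (cases v rule: string_of.cases)
  case (1 s w)
  then have "w \<in> words n" using assms by (simp add: states_def)
  then obtain u a t where w: "w = 1 # u @ a # t" "dyck u" "a \<noteq> 1"
    using words_decomp[OF _ assms(1)] by (metis append_Cons)
  then show ?thesis
    using 1 star_adj_rotate[of 1 a s "1 # u" t] rot_tree_eq[of u a t] by (simp add: butlast_append)
next
  case (2 s w)
  then obtain d r where w: "w = d @ [r]" "length d = 2 * n" "r \<noteq> 1"
    using assms by (auto simp: states_def words_def)
  \<comment> \<open>Rotating \<open>w\<close> by \<open>length d\<close> moves the root label to the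
    front, where the swapped 1 stood.\<close>
  have "rotate ((s + 2 * n) mod (2 * n + 1)) w = rotate (s + 2 * n) w"
    using w rotate_conv_mod[of "s + 2 * n" w] by simp
  also have "\<dots> = rotate s (rotate (length d) w)" using w(2) by (simp add: rotate_rotate)
  also have "\<dots> = rotate s (r # d)" using w(1) by (simp add: rotate_append)
  finally show ?thesis using 2 w star_adj_rotate[of r 1 s "[]" d] by simp
qed

subsection \<open>Gluing the cycles\<close>

text \<open>The Dyck condition makes the 2 after \<open>u\<close> the partner of the first 1. So the
  root's first child and the leaf to be pulled from it are both unmarked.\<close>

definition pullable :: "nat \<Rightarrow> nat list set" where
  "pullable n = {w \<in> words n. \<exists>u v. w = 1 # 1 # 2 # u @ 2 # v \<and> dyck u}"

definition pulled :: "nat list \<Rightarrow> nat list" where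
  "pulled w = 1 # 2 # 1 # drop 3 w"

text \<open>Six consecutive states of the 2-factor, starting at \<open>(False, 0, w)\<close>, and
  the state of the pulled tree: the points at which a gluing alters the permutation.\<close>

definition glue_support :: "nat \<Rightarrow> nat list \<Rightarrow> (bool \<times> nat \<times> nat list) set" where
  "glue_support n w =
    {(False, 0, w), (True, 0, rot_tree w), (False, 2 * n, rot_tree w),
     (True, 2 * n, rot_tree (rot_tree w)), (False, 2 * n - 1, rot_tree (rot_tree w)),
     (True, 2 * n - 1, rot_tree (rot_tree (rot_tree w))), (False, 0, pulled w)}"

lemma pulled_words: "w \<in> pullable n \<Longrightarrow> pulled w \<in> words n"
  using words_pull by (auto simp: pullable_def pulled_def)

lemma pullable_ge2: "w \<in> pullable n \<Longrightarrow> 2 \<le> n"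
  using length_words[of w n] by (auto simp: pullable_def)

text \<open>The offsets 0, \<open>2 * n - 1\<close> and \<open>2 * n\<close> differ, so injectivity
  of \<open>rot_tree\<close> settles all coincidences but those of a pulled tree with a pullable
  one. These differ in their second letter.\<close>

lemma glue_support_disjoint:
  assumes w: "w \<in> pullable n" and w': "w' \<in> pullable n" and "w \<noteq> w'"
  shows "glue_support n w \<inter> glue_support n w' = {}"
proof -
  have n: "2 \<le> n" using pullable_ge2[OF w] .
  have mem: "w \<in> words n" "w' \<in> words n" using w w' by (auto simp: pullable_def)
  have inj: "rot_tree a \<noteq> rot_tree b" if "a \<noteq> b" "a \<in> words n" "b \<in> words n" for a b
    using inj_onD[OF inj_on_rot_tree[of n], of a b] that n by auto
  have 1: "rot_tree w \<noteq> rot_tree w'" using inj assms(3) mem by blast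
  have 2: "rot_tree (rot_tree w) \<noteq> rot_tree (rot_tree w')"
    using inj[OF 1] rot_tree_words mem n by simp
  have 3: "rot_tree (rot_tree (rot_tree w)) \<noteq> rot_tree (rot_tree (rot_tree w'))"
    using inj[OF 2] rot_tree_words mem n by simp
  obtain v v' where v: "w = 1 # 1 # 2 # v" "w' = 1 # 1 # 2 # v'"
    using w w' unfolding pullable_def by blast
  then have 4: "pulled w \<noteq> pulled w'" "pulled w \<noteq> w'" "pulled w' \<noteq> w"
    using assms(3) by (simp_all add: pulled_def)
  have "{(False, 0, a0), (True, 0, a1), (False, k, a1), (True, k, a2), (False, l, a2), (True, l, a3),
      (False, 0, a4)} \<inter> {(False, 0, b0), (True, 0, b1), (False, k, b1), (True, k, b2), (False, l, b2),
      (True, l, b3), (False, 0, b4)} = {}"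
    if "a0 \<noteq> b0" "a1 \<noteq> b1" "a2 \<noteq> b2" "a3 \<noteq> b3" "a4 \<noteq> b4" "a4 \<noteq> b0" "b4 \<noteq> a0" "0 < l" "l < k"
    for k l :: nat and a0 a1 a2 a3 a4 b0 b1 b2 b3 b4 :: "nat list"
    using that by auto
  note disjoint = this
  have "0 < 2 * n - 1" "2 * n - 1 < 2 * n" using n by linarith+
  then show ?thesis
    unfolding glue_support_def by (rule disjoint[OF assms(3) 1 2 3 4])
qed

text \<open>Greedy gluing by induction on \<open>K\<close>. The invariant that \<open>f\<close>
  agrees with \<open>step n\<close> off the supports used so far leaves the path at the next site
  intact.\<close>

lemma exists_glued_permutation:
  assumes n: "0 < n" and K: "finite K" "K \<subseteq> pullable n"
  shows "\<exists>f. inj_on f (states n) \<and> f ` states n \<subseteq> states n \<and>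
    (\<forall>v\<in>states n. star_adj (string_of v) (string_of (f v))) \<and>
    (\<forall>v\<in>states n - \<Union> (glue_support n ` K). f v = step n v) \<and>
    (\<forall>a b. step_eq (states n) (step n) a b \<longrightarrow> step_eq (states n) f a b) \<and>
    (\<forall>w\<in>K. step_eq (states n) f (False, 0, w) (False, 0, pulled w))"
  using K
proof (induction K)
  case empty
  then show ?case
    using inj_on_step[OF n] step_in[OF n] step_adj[OF n] by (intro exI[of _ "step n"]) auto
next
  case (insert w K)
  then obtain f where f: "inj_on f (states n)" "f ` states n \<subseteq> states n"
    and adj: "\<And>v. v \<in> states n \<Longrightarrow> star_adj (string_of v) (string_of (f v))"
    and unch: "\<And>v. v \<in> states n \<Longrightarrow> v \<notin> \<Union> (glue_support n ` K) \<Longrightarrow> f v = step n v"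
    and ext: "\<And>a b. step_eq (states n) (step n) a b \<Longrightarrow> step_eq (states n) f a b"
    and glued: "\<And>w. w \<in> K \<Longrightarrow> step_eq (states n) f (False, 0, w) (False, 0, pulled w)"
    by auto
  have wK: "w \<in> pullable n" using insert by blast
  then have n2: "2 \<le> n" by (rule pullable_ge2)
  obtain u v where w: "w = 1 # 1 # 2 # u @ 2 # v" "dyck u" and wW: "w \<in> words n"
    using wK by (auto simp: pullable_def)
  let ?g1 = "rot_tree w" let ?g2 = "rot_tree ?g1" let ?g3 = "rot_tree ?g2"
  define x where "x = (False, 0 :: nat, w)"
  define x' where "x' = (True, 0 :: nat, ?g1)"
  define x1 where "x1 = (False, 2 * n, ?g1)"
  define x1' where "x1' = (True, 2 * n, ?g2)"
  define p where "p = (False, 2 * n - 1, ?g2)"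
  define p' where "p' = (True, 2 * n - 1, ?g3)"
  define z where "z = (False, 2 * n - 2, ?g3)"
  define y where "y = (False, 0 :: nat, pulled w)"
  note defs = x_def x'_def x1_def x1'_def p_def p'_def z_def y_def
  have supp: "glue_support n w = {x, x', x1, x1', p, p', y}"
    by (simp add: glue_support_def defs)
  have gW: "?g1 \<in> words n" "?g2 \<in> words n" "?g3 \<in> words n"
    using rot_tree_words[OF _ n] wW by blast+
  have mem: "x \<in> states n" "x' \<in> states n" "x1 \<in> states n" "x1' \<in> states n" "p \<in> states n"
    "p' \<in> states n" "y \<in> states n"
    using gW wW pulled_words[OF wK] by (simp_all add: defs states_def)
  have f_step: "f c = step n c" if "c \<in> glue_support n w" for c
  proof (rule unch)
    show "c \<in> states n" using that mem supp by auto
    have "glue_support n w \<inter> glue_support n w' = {}" if "w' \<in> K" for w'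
      using glue_support_disjoint[OF wK] that insert by blast
    then show "c \<notin> \<Union> (glue_support n ` K)" using that by blast
  qed
  have path: "f x = x'" "f x' = x1" "f x1 = x1'" "f x1' = p" "f p = p'" "f p' = z"
    using f_step supp shift_mod[of "2 * n" n] shift_mod[of "2 * n - 1" n] n2 by (simp_all add: defs)
  have "2 * n \<noteq> 2 * n - 1" "2 * n \<noteq> 0" "2 * n - 1 \<noteq> 0" using n2 by linarith+
  moreover have "pulled w \<noteq> w" using w by (simp add: pulled_def)
  ultimately have dist: "distinct [x, x', x1, x1', p, p']" and y: "y \<notin> {x, x', x1, x1', p, p'}"
    by (auto simp: defs)
  show ?case
  \<comment> \<open>\<open>merge_orbits\<close> joins two different orbits; if \<open>x\<close> and
    \<open>y\<close> already share one, \<open>f\<close> itself serves.\<close>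
  proof (cases "step_eq (states n) f x y")
    case True
    then have "\<forall>w'\<in>insert w K. step_eq (states n) f (False, 0, w') (False, 0, pulled w')"
      using glued by (simp add: x_def y_def)
    moreover have "\<forall>c\<in>states n - \<Union> (glue_support n ` insert w K). f c = step n c"
      using unch by simp
    ultimately show ?thesis using f adj ext by (intro exI[of _ f]) blast
  next
    case False
    define g where
      "g = f(x := f y, y := p', p' := p, p := x1', x1' := x1, x1 := x', x' := z)"
    note merge = merge_orbits[OF finite_states f path mem(1,7) False dist, folded g_def]
    have g: "g x = f y" "g y = p'" "g p' = p" "g p = x1'" "g x1' = x1" "g x1 = x'" "g x' = z"
      using dist y by (auto simp: g_def)
    have g_other: "g c = f c" if "c \<notin> glue_support n w" for c
      using that unfolding supp g_def by auto
    obtain u0 a v0 r where w0: "w = 1 # u0 @ a # v0 @ [r]" "dyck u0" "a \<noteq> 1" "dyck v0" "r \<noteq> 1"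
      using words_decomp[OF wW n] .
    have u12: "dyck (1 # 2 # u)" using dyck.Cons[of "[]" 2 u] w by simp
    \<comment> \<open>Uniqueness of the first return shows that \<open>v\<close> is a Dyck word
      followed by the root label.\<close>
    have "u0 @ a # (v0 @ [r]) = (1 # 2 # u) @ 2 # v" using w0(1) w(1) by simp
    then have v: "v = v0 @ [r]" "dyck v0" "r \<noteq> 1"
      using first_return_unique[OF w0(2) u12 w0(3), of 2 "v0 @ [r]" v] w0(4,5) by simp_all
    have g1: "?g1 = (1 # 2 # u @ 1 # v) @ [2]" using rot_tree_eq[OF u12, of 2 v] w by simp
    have g2: "?g2 = 1 # u @ 1 # v @ [2, 2]"
      unfolding g1 using rot_tree_eq[of "[]" 2 "u @ 1 # v @ [2]"] by simp
    have "dyck (u @ 1 # v)" using dyck_append[OF w(2) dyck.Cons[OF v(2,3) dyck.Nil]] v(1) by simp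
    then have g3: "?g3 = (u @ 1 # v @ [1, 2]) @ [2]"
      unfolding g2 using rot_tree_eq[of "u @ 1 # v" 2 "[2]"] by simp
    \<comment> \<open>These are the offsets of \<open>p'\<close> and \<open>z\<close>, so the
      rotations in their strings move exactly these blocks to the end.\<close>
    have len: "length (1 # u @ 1 # v) = 2 * n - 1" "length (u @ 1 # v) = 2 * n - 2"
      using length_words[OF wW] w(1) by simp_all
    have px: "string_of x = 1 # [1, 1] @ 2 # (u @ 2 # v)" using w(1) by (simp add: x_def)
    have py: "string_of y = 1 # (1 # 2 # 1 # u) @ 2 # v" using w(1) by (simp add: y_def pulled_def)
    have px': "string_of x' = 2 # [1] @ 1 # (2 # u @ 1 # v)"
      unfolding x'_def g1 by (simp add: butlast_append)
    have pp': "string_of p' = 2 # (1 # 2 # 1 # u) @ 1 # v"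
      using rotate_append[of "1 # u @ 1 # v" "[1, 2]"] unfolding p'_def g3 len by (simp add: butlast_append)
    have pz: "string_of z = 1 # [1] @ 2 # (2 # u @ 1 # v)"
      using rotate_append[of "u @ 1 # v" "[1, 2, 2]"] unfolding z_def g3 len by simp
    have "f y = step n y" using f_step[of y] supp by simp
    then have "f y = (True, 0, (1 # 1 # u @ 2 # v) @ [2])"
      using rot_tree_eq[of "[]" 2 "1 # u @ 2 # v"] w(1) by (simp add: y_def pulled_def)
    then have pfy: "string_of (f y) = 2 # [1, 1] @ 1 # (u @ 2 # v)" by (simp add: butlast_append)
    \<comment> \<open>The 6-cycle is \<open>x\<close>, \<open>x'\<close>, \<open>z\<close>,
      \<open>p'\<close>, \<open>y\<close>, \<open>f y\<close>. Its edges from \<open>x\<close> to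
      \<open>x'\<close>, \<open>p'\<close> to \<open>z\<close> and \<open>y\<close> to
      \<open>f y\<close> are given up for the other three; the rest of the path is only
      reversed.\<close>
    have "star_adj (string_of c) (string_of (g c))" if "c \<in> states n" for c
    proof (cases "c \<in> glue_support n w")
      case True
      have "star_adj (string_of x) (string_of (g x))"
        unfolding g px pfy star_adj_def by (intro exI conjI, rule refl, rule refl) simp
      moreover have "star_adj (string_of y) (string_of (g y))"
        unfolding g py pp' star_adj_def by (intro exI conjI, rule refl, rule refl) simp
      moreover have "star_adj (string_of x') (string_of (g x'))"
        unfolding g px' pz star_adj_def by (intro exI conjI, rule refl, rule refl) simp
      moreover have "star_adj (string_of p') (string_of (g p'))" "star_adj (string_of p) (string_of (g p))"
        "star_adj (string_of x1') (string_of (g x1'))" "star_adj (string_of x1) (string_of (g x1))"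
        using adj[OF mem(5)] adj[OF mem(4)] adj[OF mem(3)] adj[OF mem(2)] star_adj_sym
        by (simp_all add: g path)
      ultimately show ?thesis using True unfolding supp by blast
    next
      case False
      then show ?thesis using adj[OF that] g_other by simp
    qed
    moreover have "g c = step n c" if "c \<in> states n - \<Union> (glue_support n ` insert w K)" for c
      using unch[of c] g_other[of c] that by auto
    moreover have "step_eq (states n) g a b" if "step_eq (states n) (step n) a b" for a b
      using merge(3)[OF ext[OF that]] .
    moreover have "step_eq (states n) g (False, 0, w') (False, 0, pulled w')" if "w' \<in> insert w K" for w'
      using that merge(3)[OF glued] merge(4) by (auto simp: x_def y_def)
    ultimately show ?thesis using merge(1,2) by (intro exI[of _ g]) blast
  qed
qed

subsection \<open>The Hamilton cycle\<close>

text \<open>Once all offsets of a word are joined, every state reduces to a word at offset 0, and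
  \<open>words_connected\<close> applies.\<close>

lemma states_connected:
  assumes n: "0 < n" and E: "equivp E"
    and step: "\<And>v. v \<in> states n \<Longrightarrow> E v (step n v)"
    and pull: "\<And>w. w \<in> pullable n \<Longrightarrow> E (False, 0, w) (False, 0, pulled w)"
    and a: "a \<in> states n" and b: "b \<in> states n"
  shows "E a b"
proof -
  have trans: "E x z" if "E x y" "E y z" for x y z using E that by (blast elim: equivpE dest: transpD)
  have sym: "E y x" if "E x y" for x y using E that by (blast elim: equivpE dest: sympD)
  have refl: "E x x" for x using E by (blast elim: equivpE dest: reflpD)
  let ?N = "2 * n + 1"
  have two: "E (False, s, w) (False, (s + 2 * n) mod ?N, rot_tree w)" if "w \<in> words n" "s < ?N" for s w
    using trans[OF step[of "(False, s, w)"]] step[of "(True, s, rot_tree w)"] that rot_tree_words[OF that(1) n]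
    by (simp add: states_def)
  have pow: "E (False, s, w) (False, (s + k * (2 * n)) mod ?N, (rot_tree ^^ k) w)"
    if "w \<in> words n" "s < ?N" for s w k
  proof (induction k)
    case 0
    then show ?case using that refl by simp
  next
    case (Suc k)
    have "((s + k * (2 * n)) mod ?N + 2 * n) mod ?N = (s + Suc k * (2 * n)) mod ?N"
      by (simp only: mod_add_left_eq mult_Suc add.assoc add.commute[of "2 * n"])
    then show ?case
      using trans[OF Suc two[OF rot_tree_power_words[OF that(1) n], of "(s + k * (2 * n)) mod ?N" k]]
      by simp
  qed
  have shift: "E (False, s, w) (False, 0, w)" if w: "w \<in> words n" and "s < ?N" for s w
    using \<open>s < ?N\<close>
  proof (induction s)
    case 0
    show ?case by (rule refl)
  next
    case (Suc s)
    \<comment> \<open>After \<open>2 * n\<close> double steps the word is back, while the offset has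
      decreased by \<open>2 * n\<close>, that is, increased by 1 modulo
      \<open>2 * n + 1\<close>.\<close>
    have "s + 2 * n * (2 * n) = Suc s + (2 * n - 1) * ?N"
      using n by (cases n) (simp_all add: algebra_simps)
    then have "(s + 2 * n * (2 * n)) mod ?N = Suc s" using Suc.prems by (metis mod_less mod_mult_self1)
    then have "E (False, s, w) (False, Suc s, w)"
      using pow[OF w, of s "2 * n"] rot_tree_period[OF w] Suc.prems by simp
    then have "E (False, Suc s, w) (False, s, w)" by (rule sym)
    moreover have "E (False, s, w) (False, 0, w)" using Suc by simp
    ultimately show ?case by (rule trans)
  qed
  have word: "E (False, 0, w) (False, 0, w')" if "w \<in> words n" "w' \<in> words n" for w w'
  proof (rule words_connected[OF _ n _ _ that, of "\<lambda>w w'. E (False, 0, w) (False, 0, w')"])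
    show "equivp (\<lambda>w w'. E (False, 0, w) (False, 0, w'))"
      by (intro equivpI reflpI sympI transpI) (fact refl, erule sym, erule trans, assumption)
    show "E (False, 0, w) (False, 0, rot_tree w)" if "w \<in> words n" for w
      using trans[OF two[OF that, of 0] shift[OF rot_tree_words[OF that n]]] by simp
    show "E (False, 0, 1 # 1 # 2 # u @ 2 # v) (False, 0, 1 # 2 # 1 # u @ 2 # v)"
      if "1 # 1 # 2 # u @ 2 # v \<in> words n" "dyck u" for u v
      using pull[of "1 # 1 # 2 # u @ 2 # v"] that by (auto simp: pullable_def pulled_def)
  qed
  have base: "\<exists>w\<in>words n. E v (False, 0, w)" if v: "v \<in> states n" for v
  proof (cases v rule: string_of.cases)
    case (1 s w)
    then show ?thesis using v shift[of w s] by (auto simp: states_def)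
  next
    case (2 s w)
    then have w: "w \<in> words n" and "E v (False, (s + 2 * n) mod ?N, w)"
      using v step[OF v] by (auto simp: states_def)
    moreover have "E (False, (s + 2 * n) mod ?N, w) (False, 0, w)" using shift[OF w] by simp
    ultimately show ?thesis using trans by blast
  qed
  obtain w w' where "w \<in> words n" "w' \<in> words n" "E a (False, 0, w)" "E b (False, 0, w')"
    using base[OF a] base[OF b] by blast
  then show ?thesis using trans[OF _ trans[OF word sym]] by blast
qed

lemma cas_iterates:
  assumes "i \<le> j"
  shows "pre_digraph.cas (with_proj G) (h i) (map (\<lambda>k. (h k, h (Suc k))) [i..<j]) (h j)"
  using assms by (induction rule: inc_induct) (simp_all add: pre_digraph.cas.simps upt_conv_Cons)

lemma awalk_verts_iterates:
  assumes "i \<le> j"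
  shows "pre_digraph.awalk_verts (with_proj G) (h i) (map (\<lambda>k. (h k, h (Suc k))) [i..<j]) =
    map h [i..<Suc j]"
  using assms
  by (induction rule: inc_induct)
    (simp_all add: pre_digraph.awalk_verts.simps upt_conv_Cons del: upt_Suc)

text \<open>A permutation with a single orbit runs through all of \<open>V\<close> before it first
  returns, and \<open>\<phi>\<close> carries this run to the graph.\<close>

lemma hamilton_cycle_of_iterates:
  fixes f :: "'v \<Rightarrow> 'v" and G :: "'a pair_pre_digraph"
  assumes V: "finite V" "inj_on f V" "f ` V \<subseteq> V" and card: "3 \<le> card V"
    and trans: "\<And>a b. a \<in> V \<Longrightarrow> b \<in> V \<Longrightarrow> step_eq V f a b"
    and bij: "bij_betw \<phi> V (pverts G)" and arcs: "\<And>v. v \<in> V \<Longrightarrow> (\<phi> v, \<phi> (f v)) \<in> parcs G"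
  shows "\<exists>p. hamilton_cycle (with_proj G) p"
proof -
  have "V \<noteq> {}" using card by auto
  then obtain v where v: "v \<in> V" by blast
  define m where "m = (LEAST k. 0 < k \<and> (f ^^ k) v = v)"
  obtain k where "0 < k \<and> (f ^^ k) v = v" using funpow_returns[OF V v] by blast
  then have m: "0 < m" "(f ^^ m) v = v" unfolding m_def by (metis (mono_tags, lifting) LeastI)+
  have least: "(f ^^ k) v \<noteq> v" if "0 < k" "k < m" for k
    using not_less_Least[of k "\<lambda>k. 0 < k \<and> (f ^^ k) v = v"] that by (simp add: m_def)
  have inV: "(f ^^ k) v \<in> V" for k using funpow_in[OF V(3) v] .
  have orbit: "(\<lambda>k. (f ^^ k) v) ` {..<m} = V"
  proof (intro subset_antisym subsetI)
    fix b assume "b \<in> V"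
    then obtain k where "b = (f ^^ k) v" using step_eq_reach[OF V v trans[OF v]] by blast
    then have "b = (f ^^ (k mod m)) v" using funpow_mod_eq[OF m(2)] by metis
    then show "b \<in> (\<lambda>k. (f ^^ k) v) ` {..<m}" using m(1) by auto
  qed (use inV in auto)
  define h where "h k = \<phi> ((f ^^ k) v)" for k
  define p where "p = map (\<lambda>k. (h k, h (Suc k))) [0..<m]"
  have "card V \<le> m" using orbit card_image_le[of "{..<m}" "\<lambda>k. (f ^^ k) v"] by simp
  then have m3: "3 \<le> m" using card by simp
  have img: "h ` {..<m} = pverts G"
    using orbit bij unfolding h_def bij_betw_def by (metis image_image)
  have "h m = h 0" by (simp add: h_def m(2))
  \<comment> \<open>The indices start at 1 because \<open>cycle\<close> requires distinct vertices
    after dropping the first, which recurs at the end.\<close>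
  have "inj_on h {1..m}"
  proof (rule linorder_inj_onI)
    fix i j assume ij: "i < j" "i \<in> {1..m}" "j \<in> {1..m}"
    show "h i \<noteq> h j"
    proof
      assume "h i = h j"
      then have "(f ^^ i) v = (f ^^ j) v"
        using bij inV unfolding h_def bij_betw_def by (blast dest: inj_onD)
      then have "(f ^^ (j - i)) v = v" using funpow_cancel[OF V(2,3) v] ij(1) by simp
      moreover have "j - i < m" using ij by auto
      ultimately show False using least[of "j - i"] ij(1) by simp
    qed
  qed auto
  moreover have "set [1..<Suc m] = {1..m}" by auto
  ultimately have dist: "distinct (map h [1..<Suc m])" by (simp only: distinct_map distinct_upt)
  have "pre_digraph.awalk (with_proj G) (h 0) p (h 0)"
    unfolding pre_digraph.awalk_def
  proof (intro conjI)
    show "h 0 \<in> verts (with_proj G)" using img m(1) by auto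
    show "set p \<subseteq> Digraph.pre_digraph.arcs (with_proj G)"
      using arcs[OF inV] by (auto simp: p_def h_def)
    show "pre_digraph.cas (with_proj G) (h 0) p (h 0)"
      using cas_iterates[of 0 m G h] \<open>h m = h 0\<close> by (simp add: p_def)
  qed
  moreover have "tl (pre_digraph.awalk_verts (with_proj G) (h 0) p) = map h [1..<Suc m]"
    unfolding p_def awalk_verts_iterates[OF le0] by (simp add: upt_conv_Cons del: upt_Suc)
  ultimately have "pre_digraph.cycle (with_proj G) p"
    unfolding pre_digraph.cycle_def using dist m(1) by (auto simp: p_def)
  moreover have "tail (with_proj G) ` set p = verts (with_proj G)"
    using img by (simp add: p_def image_image atLeast0LessThan)
  ultimately show ?thesis using m3 unfolding hamilton_cycle_def by (intro exI[of _ p]) (auto simp: p_def)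
qed

lemma star_word: "concat (replicate n [1, 2]) @ [3] \<in> words n"
proof -
  have "dyck (concat (replicate n [1, 2]))"
    using dyck.Cons[OF dyck.Nil, of 2] by (induction n) auto
  moreover have "count_list (concat (replicate n [1, 2 :: nat])) 3 = 0"
    by (induction n) auto
  moreover have "length (concat (replicate n [1, 2 :: nat])) = 2 * n"
    by (induction n) auto
  ultimately show ?thesis by (auto simp: words_def)
qed

theorem theorem9:
  fixes \<alpha> :: nat
  assumes "\<alpha> \<ge> 2"
  shows "\<exists>p. hamilton_cycle (with_proj (star_transposition_graph [\<alpha>, \<alpha> - 1, 1])) p"
proof -
  obtain n where \<alpha>: "\<alpha> = n + 1" and n: "0 < n" using assms by (cases \<alpha>) auto
  have "finite (pullable n)" using finite_words by (simp add: pullable_def)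
  then obtain f where f: "inj_on f (states n)" "f ` states n \<subseteq> states n"
    and adj: "\<And>v. v \<in> states n \<Longrightarrow> star_adj (string_of v) (string_of (f v))"
    and ext: "\<And>a b. step_eq (states n) (step n) a b \<Longrightarrow> step_eq (states n) f a b"
    and glued: "\<And>w. w \<in> pullable n \<Longrightarrow> step_eq (states n) f (False, 0, w) (False, 0, pulled w)"
    using exists_glued_permutation[OF n, of "pullable n"] by auto
  let ?w = "concat (replicate n [1, 2]) @ [3] :: nat list"
  \<comment> \<open>Three offsets are available because \<open>n\<close> is positive; they give the
    minimal length 3 of a Hamilton cycle.\<close>
  have "{(False, 0, ?w), (False, 1, ?w), (False, 2, ?w)} \<subseteq> states n"
    using star_word[of n] n by (auto simp: states_def)
  then have "card {(False, 0 :: nat, ?w), (False, 1, ?w), (False, 2, ?w)} \<le> card (states n)"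
    by (rule card_mono[OF finite_states])
  then have card: "3 \<le> card (states n)" by simp
  show ?thesis
  proof (rule hamilton_cycle_of_iterates[OF finite_states f card])
    show "step_eq (states n) f a b" if "a \<in> states n" "b \<in> states n" for a b
      using states_connected[OF n equivp_step_eq, of "states n" f a b] ext[OF step_eq_step] glued that by blast
    show "bij_betw string_of (states n) (pverts (star_transposition_graph [\<alpha>, \<alpha> - 1, 1]))"
      using bij_betw_string_of[of n] \<alpha> by (simp add: star_transposition_graph_def)
    show "(string_of v, string_of (f v)) \<in> parcs (star_transposition_graph [\<alpha>, \<alpha> - 1, 1])" if "v \<in> states n" for v
      using star_adj_arc[OF adj[OF that]] string_of_in[OF that] string_of_in[of "f v" n] f(2) that \<alpha> by auto
  qed
qed

end
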